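(* Let $(Z,d)$ be a finite ep-metric space, let $k \geq 1$ be an integer and let $S \geq 0$ be a real number. Let $V(k\text{-}N)$ be the neighbourhood complex constructed from all $k$-bounded neighbourhoods of all points of $Z$. Suppose that $0 \leq t \leq S$. Then the function $$\pi_0 V_t(k\text{-}N) \to \pi_0 V_t(Z)$$ induced by inclusion is a bijection.
   Context: An ep-metric space (extended pseudo-metric space) $(Z,d)$ is a set $Z$ with a function $d : Z\times Z \to [0,\infty]$ such that $d(x,x)=0$, $d(x,y)=d(y,x)$ and $d(x,z) \leq d(x,y)+d(y,z)$. Distinct points may have distance $0$, and distances may be infinite. With $k$ and $S$ fixed, a $k$-bounded neighbourhood of $x \in Z$ is a subset $N \subset Z(x,S) = \{y \in Z \mid d(x,y) \leq S\}$ with $x \in N$ and $|N| \leq k+1$. For a subset $M \subset Z$ and $t \geq 0$, $V_t(M)$ is the Vietoris-Rips complex: the abstract simplicial complex whose simplices are the non-empty finite subsets $\sigma \subset M$ with $d(u,v)\leq t$ for all $u,v\in\sigma$. The neighbourhood complex is $V_t(k\text{-}N) = \bigcup V_t(N) \subset V_t(Z)$, the union over all $k$-bounded neighbourhoods $N$ of all $x \in Z$. $\pi_0$ denotes the set of path components. *)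

theory Defs
  imports "HOL-Analysis.Analysis"
begin

section \<open>Extended pseudo-metric spaces\<close>

locale ep_metric =
  fixes Z :: "'a set" and d :: "'a \<Rightarrow> 'a \<Rightarrow> ennreal"
  assumes zero: "x \<in> Z \<Longrightarrow> d x x = 0"
    and sym: "\<lbrakk>x \<in> Z; y \<in> Z\<rbrakk> \<Longrightarrow> d x y = d y x"
    and triangle: "\<lbrakk>x \<in> Z; y \<in> Z; z \<in> Z\<rbrakk> \<Longrightarrow> d x z \<le> d x y + d y z"

section \<open>Vietoris-Rips and neighbourhood complexes\<close>

text \<open>An abstract simplicial complex is represented by its set of simplices.\<close>

definition VR :: "('a \<Rightarrow> 'a \<Rightarrow> ennreal) \<Rightarrow> real \<Rightarrow> 'a set \<Rightarrow> 'a set set" where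
  "VR d t M = {\<sigma>. \<sigma> \<noteq> {} \<and> finite \<sigma> \<and> \<sigma> \<subseteq> M \<and> (\<forall>u\<in>\<sigma>. \<forall>v\<in>\<sigma>. d u v \<le> ennreal t)}"

text \<open>Finiteness of \<open>N\<close> is explicit because \<^const>\<open>card\<close> is 0 on infinite sets.\<close>

definition bounded_nbhd ::
  "'a set \<Rightarrow> ('a \<Rightarrow> 'a \<Rightarrow> ennreal) \<Rightarrow> nat \<Rightarrow> real \<Rightarrow> 'a \<Rightarrow> 'a set \<Rightarrow> bool" where
  "bounded_nbhd Z d k S x N \<longleftrightarrow>
     N \<subseteq> {y \<in> Z. d x y \<le> ennreal S} \<and> x \<in> N \<and> finite N \<and> card N \<le> k + 1"

definition VR_nbhd ::
  "'a set \<Rightarrow> ('a \<Rightarrow> 'a \<Rightarrow> ennreal) \<Rightarrow> nat \<Rightarrow> real \<Rightarrow> real \<Rightarrow> 'a set set" where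
  "VR_nbhd Z d k S t = (\<Union>x\<in>Z. \<Union>N\<in>{N. bounded_nbhd Z d k S x N}. VR d t N)"

lemma VR_nbhd_subset: "VR_nbhd Z d k S t \<subseteq> VR d t Z"
  unfolding VR_nbhd_def VR_def bounded_nbhd_def by blast

section \<open>Geometric realization\<close>

text \<open>Barycentric coordinates, extended by 0 to the ambient vertex type; the topology is the
  one inherited from the product topology on functions.\<close>

definition cell :: "'a set \<Rightarrow> ('a \<Rightarrow> real) set" where
  "cell \<sigma> = {f. (\<forall>v. 0 \<le> f v) \<and> (\<forall>v. v \<notin> \<sigma> \<longrightarrow> f v = 0) \<and> (\<Sum>v\<in>\<sigma>. f v) = 1}"

text \<open>The realization is the union of the closed cells with the weak (coherent) topology.\<close>

definition realization :: "'a set set \<Rightarrow> ('a \<Rightarrow> real) topology" where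
  "realization K = topology (\<lambda>U. U \<subseteq> \<Union>(cell ` K) \<and>
     (\<forall>\<sigma>\<in>K. openin (top_of_set (cell \<sigma>)) (U \<inter> cell \<sigma>)))"

lemma openin_realization:
  "openin (realization K) U \<longleftrightarrow>
     U \<subseteq> \<Union>(cell ` K) \<and> (\<forall>\<sigma>\<in>K. openin (top_of_set (cell \<sigma>)) (U \<inter> cell \<sigma>))"
proof -
  have "istopology (\<lambda>U. U \<subseteq> \<Union>(cell ` K) \<and>
     (\<forall>\<sigma>\<in>K. openin (top_of_set (cell \<sigma>)) (U \<inter> cell \<sigma>)))"
    unfolding istopology_def
  proof (intro conjI allI impI ballI)
    fix A B \<sigma>
    assume A: "A \<subseteq> \<Union>(cell ` K) \<and> (\<forall>\<sigma>\<in>K. openin (top_of_set (cell \<sigma>)) (A \<inter> cell \<sigma>))"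
      and B: "B \<subseteq> \<Union>(cell ` K) \<and> (\<forall>\<sigma>\<in>K. openin (top_of_set (cell \<sigma>)) (B \<inter> cell \<sigma>))"
    show "A \<inter> B \<subseteq> \<Union>(cell ` K)" using A by blast
    assume "\<sigma> \<in> K"
    then have "openin (top_of_set (cell \<sigma>)) ((A \<inter> cell \<sigma>) \<inter> (B \<inter> cell \<sigma>))"
      using A B by (intro openin_Int[of _ "A \<inter> cell \<sigma>" "B \<inter> cell \<sigma>"]) simp_all
    then show "openin (top_of_set (cell \<sigma>)) (A \<inter> B \<inter> cell \<sigma>)"
      by (simp add: Int_ac)
  next
    fix \<U> :: "('a \<Rightarrow> real) set set" and \<sigma>
    assume *: "\<forall>U\<in>\<U>. U \<subseteq> \<Union>(cell ` K) \<and> (\<forall>\<sigma>\<in>K. openin (top_of_set (cell \<sigma>)) (U \<inter> cell \<sigma>))"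
    show "\<Union>\<U> \<subseteq> \<Union>(cell ` K)" using * by blast
    assume "\<sigma> \<in> K"
    then have "openin (top_of_set (cell \<sigma>)) (\<Union>U\<in>\<U>. U \<inter> cell \<sigma>)"
      using * by (intro openin_Union) auto
    then show "openin (top_of_set (cell \<sigma>)) (\<Union>\<U> \<inter> cell \<sigma>)"
      unfolding Int_Union2 .
  qed
  then show ?thesis
    unfolding realization_def by (simp add: topology_inverse')
qed

lemma topspace_realization: "topspace (realization K) = \<Union>(cell ` K)"
proof
  show "topspace (realization K) \<subseteq> \<Union>(cell ` K)"
    using openin_topspace[of "realization K"] unfolding openin_realization by (rule conjunct1)
  have "openin (realization K) (\<Union>(cell ` K))"
  proof -
    have "\<Union>(cell ` K) \<inter> cell \<sigma> = cell \<sigma>" if "\<sigma> \<in> K" for \<sigma> using that by blast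
    then show ?thesis by (simp add: openin_realization)
  qed
  then show "\<Union>(cell ` K) \<subseteq> topspace (realization K)"
    by (rule openin_subset)
qed

lemma continuous_map_realization_inclusion:
  assumes "K \<subseteq> L"
  shows "continuous_map (realization K) (realization L) (\<lambda>x. x)"
  unfolding continuous_map
proof (intro conjI allI impI)
  show "(\<lambda>x. x) ` topspace (realization K) \<subseteq> topspace (realization L)"
    using assms unfolding topspace_realization image_ident by blast
next
  fix U
  assume U: "openin (realization L) U"
  have "{x \<in> topspace (realization K). x \<in> U} \<inter> cell \<sigma> = U \<inter> cell \<sigma>" if "\<sigma> \<in> K" for \<sigma>
    using that unfolding topspace_realization by blast
  moreover have "\<forall>\<sigma>\<in>K. openin (top_of_set (cell \<sigma>)) (U \<inter> cell \<sigma>)"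
    using U assms unfolding openin_realization by blast
  moreover have "{x \<in> topspace (realization K). x \<in> U} \<subseteq> \<Union>(cell ` K)"
    unfolding topspace_realization by blast
  ultimately show "openin (realization K) {x \<in> topspace (realization K). x \<in> U}"
    unfolding openin_realization by simp
qed

section \<open>Path components\<close>

text \<open>The map of path components induced by \<open>f\<close>. For continuous \<open>f\<close>, the component
  of \<open>Y\<close> containing \<open>f ` C\<close> exists and is unique.\<close>

definition pi0_map ::
  "'a topology \<Rightarrow> 'b topology \<Rightarrow> ('a \<Rightarrow> 'b) \<Rightarrow> 'a set \<Rightarrow> 'b set" where
  "pi0_map X Y f C = (THE D. D \<in> path_components_of Y \<and> f ` C \<subseteq> D)"

end

theory Submission imports Defs begin

text \<open>Path components of a simplicial complex are determined by its vertices and edges. The two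
  complexes share these: if \<open>d u v \<le> t \<le> S\<close>, then the pair \<open>{u, v}\<close> is itself a
  \<open>k\<close>-bounded neighbourhood of \<open>u\<close>, because \<open>k + 1 \<ge> 2\<close>. So the statement follows from
  a general fact about an inclusion \<open>K \<subseteq> L\<close> in which every pair of vertices of a simplex of
  \<open>L\<close> is a simplex of \<open>K\<close> (lemma \<open>bij_betw_pi0_realization\<close>).

  For surjectivity, each point of the realization of \<open>L\<close> can be moved inside a closed cell to a
  vertex, and vertices lie in the realization of \<open>K\<close>. For injectivity, note that all vertices of
  a simplex of \<open>L\<close> lie in one path component of the realization of \<open>K\<close>, and that closed cells
  which meet share a vertex. Hence the union of those cells of \<open>L\<close> whose vertices lie in a given
  component contains or misses every closed cell (lemma \<open>clopen_cells_over_path_component\<close>). It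
  is therefore clopen in the weak topology, and a path in the realization of \<open>L\<close> cannot leave it.
  Within the realization of \<open>K\<close> this union is just the given component.\<close>

section \<open>Maps induced on path components\<close>

lemma pi0_map_path_component_of_set:
  assumes f: "continuous_map X Y f" and x: "x \<in> topspace X"
  shows "pi0_map X Y f (path_component_of_set X x) = path_component_of_set Y (f x)"
  unfolding pi0_map_def
proof (rule the_equality)
  have "f x \<in> topspace Y"
    using f x by (meson continuous_map_image_subset_topspace image_subset_iff)
  moreover have "path_component_of Y (f x) (f y)" if "path_component_of X x y" for y
    using that pathin_compose[OF _ f] by (fastforce simp: path_component_of_def)
  ultimately show "path_component_of_set Y (f x) \<in> path_components_of Y \<and>
      f ` path_component_of_set X x \<subseteq> path_component_of_set Y (f x)"
    by (auto simp: path_components_of_def)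
next
  fix D assume D: "D \<in> path_components_of Y \<and> f ` path_component_of_set X x \<subseteq> D"
  then obtain y where y: "D = path_component_of_set Y y"
    by (auto simp: path_components_of_def)
  have "path_component_of X x x"
    using x by (simp add: path_component_of_refl)
  then have "path_component_of Y y (f x)"
    using D y by blast
  then show "D = path_component_of_set Y (f x)"
    using y path_component_of_equiv[of Y y "f x"] by auto
qed

lemma bij_betw_pi0_map:
  assumes f: "continuous_map X Y f"
    and inj: "\<And>x y. \<lbrakk>x \<in> topspace X; y \<in> topspace X; path_component_of Y (f x) (f y)\<rbrakk>
      \<Longrightarrow> path_component_of X x y"
    and surj: "\<And>y. y \<in> topspace Y \<Longrightarrow> \<exists>x\<in>topspace X. path_component_of Y (f x) y"
  shows "bij_betw (pi0_map X Y f) (path_components_of X) (path_components_of Y)"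
proof -
  have eq: "path_component_of_set X x = path_component_of_set X y"
    if "x \<in> topspace X" "y \<in> topspace X"
      "path_component_of_set Y (f x) = path_component_of_set Y (f y)" for x y
  proof -
    have "f y \<in> topspace Y"
      using f that by (meson continuous_map_image_subset_topspace image_subset_iff)
    then have "path_component_of Y (f x) (f y)"
      using that(3) by (metis mem_Collect_eq path_component_of_refl)
    then show ?thesis
      using inj that by (metis path_component_of_equiv)
  qed
  have "pi0_map X Y f ` path_components_of X = path_components_of Y"
  proof
    show "pi0_map X Y f ` path_components_of X \<subseteq> path_components_of Y"
      using continuous_map_image_subset_topspace[OF f]
      by (auto simp: path_components_of_def pi0_map_path_component_of_set[OF f])
    show "path_components_of Y \<subseteq> pi0_map X Y f ` path_components_of X"
    proof
      fix D assume "D \<in> path_components_of Y"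
      then obtain y where y: "y \<in> topspace Y" "D = path_component_of_set Y y"
        by (auto simp: path_components_of_def)
      then obtain x where x: "x \<in> topspace X" "path_component_of Y (f x) y"
        using surj by blast
      then have "D = pi0_map X Y f (path_component_of_set X x)"
        using y by (metis f pi0_map_path_component_of_set path_component_of_equiv)
      then show "D \<in> pi0_map X Y f ` path_components_of X"
        using x by (auto simp: path_components_of_def)
    qed
  qed
  moreover have "inj_on (pi0_map X Y f) (path_components_of X)"
  proof (rule inj_onI)
    fix C D
    assume "C \<in> path_components_of X" "D \<in> path_components_of X"
    then obtain x y where "x \<in> topspace X" "C = path_component_of_set X x"
        and "y \<in> topspace X" "D = path_component_of_set X y"
      unfolding path_components_of_def by blast
    moreover assume "pi0_map X Y f C = pi0_map X Y f D"
    ultimately show "C = D"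
      using eq[of x y] by (simp only: pi0_map_path_component_of_set[OF f])
  qed
  ultimately show ?thesis
    by (simp add: bij_betw_def)
qed

section \<open>Paths inside a closed cell\<close>

lemma segment_in_cell:
  assumes "f \<in> cell \<sigma>" "g \<in> cell \<sigma>" "s \<in> {0..1}"
  shows "(\<lambda>v. (1 - s) * f v + s * g v) \<in> cell \<sigma>"
  using assms by (simp add: cell_def sum.distrib flip: sum_distrib_left)

lemma continuous_map_cell_realization:
  assumes "\<sigma> \<in> K"
  shows "continuous_map (top_of_set (cell \<sigma>)) (realization K) (\<lambda>x. x)"
  unfolding continuous_map
proof (intro conjI allI impI)
  show "(\<lambda>x. x) ` topspace (top_of_set (cell \<sigma>)) \<subseteq> topspace (realization K)"
    using assms by (auto simp: topspace_realization)
  fix U assume "openin (realization K) U"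
  then have "openin (top_of_set (cell \<sigma>)) (U \<inter> cell \<sigma>)"
    using assms unfolding openin_realization by blast
  moreover have "{x \<in> topspace (top_of_set (cell \<sigma>)). x \<in> U} = U \<inter> cell \<sigma>"
    by auto
  ultimately show "openin (top_of_set (cell \<sigma>)) {x \<in> topspace (top_of_set (cell \<sigma>)). x \<in> U}"
    by simp
qed

lemma path_component_of_realization_cell:
  assumes "\<sigma> \<in> K" and f: "f \<in> cell \<sigma>" and g: "g \<in> cell \<sigma>"
  shows "path_component_of (realization K) f g"
proof -
  define p where "p s = (\<lambda>v. (1 - s) * f v + s * g v)" for s :: real
  have "continuous_on {0..1} p"
    unfolding p_def by (intro continuous_on_coordinatewise_then_product continuous_intros)
  then have "pathin (top_of_set (cell \<sigma>)) p"
    using segment_in_cell[OF f g] by (auto simp: pathin_def p_def)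
  then have "pathin (realization K) p"
    using pathin_compose[OF _ continuous_map_cell_realization[OF assms(1)]]
    by (fastforce simp: o_def)
  moreover have "p 0 = f" "p 1 = g"
    by (simp_all add: p_def)
  ultimately show ?thesis
    unfolding path_component_of_def by blast
qed

definition vertex :: "'a \<Rightarrow> 'a \<Rightarrow> real" where
  "vertex u = (\<lambda>v. if v = u then 1 else 0)"

lemma finite_of_mem_cell: "f \<in> cell \<sigma> \<Longrightarrow> finite \<sigma>"
  by (rule ccontr) (simp add: cell_def)

lemma vertex_in_cell: "finite \<sigma> \<Longrightarrow> u \<in> \<sigma> \<Longrightarrow> vertex u \<in> cell \<sigma>"
  by (simp add: cell_def vertex_def)

lemma cell_has_vertex:
  assumes "f \<in> cell \<sigma>"
  obtains u where "u \<in> \<sigma>" "vertex u \<in> cell \<sigma>"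
proof -
  have "\<sigma> \<noteq> {}"
    using assms by (auto simp: cell_def)
  then obtain u where u: "u \<in> \<sigma>"
    by (meson ex_in_conv)
  show thesis
    using u vertex_in_cell[OF finite_of_mem_cell[OF assms] u] by (rule that)
qed

text \<open>A vertex with nonzero barycentric coordinate at the common point is shared.\<close>

lemma cells_meet_share_vertex:
  assumes "f \<in> cell \<sigma>" "f \<in> cell \<tau>"
  obtains u where "u \<in> \<sigma>" "u \<in> \<tau>"
proof -
  have "sum f \<sigma> \<noteq> 0"
    using assms(1) by (simp add: cell_def)
  then obtain u where u: "u \<in> \<sigma>" "f u \<noteq> 0"
    by (meson sum.neutral)
  then have "u \<in> \<tau>"
    using assms(2) unfolding cell_def by blast
  with u(1) show thesis
    by (rule that)
qed

section \<open>Complexes with the same vertices and edges\<close>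

text \<open>The displayed union contains or misses each closed cell of \<open>L\<close>: cells that meet share a
  vertex, and the vertices of a simplex of \<open>L\<close> are all joined by edges of \<open>K\<close>, so they lie in
  one path component of \<open>K\<close>. In the weak topology this makes both the union and its complement
  open.\<close>

lemma clopen_cells_over_path_component:
  assumes edges: "\<And>\<sigma> u v. \<lbrakk>\<sigma> \<in> L; u \<in> \<sigma>; v \<in> \<sigma>\<rbrakk> \<Longrightarrow> {u, v} \<in> K"
  defines "U p \<equiv> \<Union>{cell \<sigma> |\<sigma>. \<sigma> \<in> L \<and> (\<exists>u\<in>\<sigma>. path_component_of (realization K) p (vertex u))}"
  shows "openin (realization L) (U p) \<and> closedin (realization L) (U p)"
    and "\<lbrakk>f \<in> U p; f \<in> cell \<tau>; \<tau> \<in> L; v \<in> \<tau>\<rbrakk> \<Longrightarrow> path_component_of (realization K) p (vertex v)"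
proof -
  have joined: "path_component_of (realization K) (vertex u) (vertex v)"
    if "\<sigma> \<in> L" "u \<in> \<sigma>" "v \<in> \<sigma>" for \<sigma> u v
    using path_component_of_realization_cell[OF edges[OF that]] by (simp add: vertex_in_cell)
  show all_vertices: "path_component_of (realization K) p (vertex v)"
    if f: "f \<in> U p" "f \<in> cell \<tau>" and \<tau>: "\<tau> \<in> L" "v \<in> \<tau>" for f \<tau> v
  proof -
    obtain \<sigma> u where \<sigma>: "\<sigma> \<in> L" "f \<in> cell \<sigma>" "u \<in> \<sigma>"
        "path_component_of (realization K) p (vertex u)"
      using f(1) unfolding U_def by blast
    obtain w where "w \<in> \<sigma>" "w \<in> \<tau>"
      using cells_meet_share_vertex \<sigma>(2) f(2) by metis
    then show ?thesis
      using \<sigma> \<tau> joined by (meson path_component_of_trans)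
  qed
  have cell_cases: "cell \<tau> \<subseteq> U p \<or> U p \<inter> cell \<tau> = {}" if "\<tau> \<in> L" for \<tau>
  proof (cases "U p \<inter> cell \<tau> = {}")
    case False
    then obtain f where f: "f \<in> U p" "f \<in> cell \<tau>" by blast
    obtain v where "v \<in> \<tau>" using cell_has_vertex[OF f(2)] by blast
    then have "cell \<tau> \<subseteq> U p"
      using all_vertices[OF f that] that unfolding U_def by blast
    then show ?thesis ..
  qed simp
  have sub: "U p \<subseteq> \<Union>(cell ` L)"
    unfolding U_def by blast
  have "openin (top_of_set (cell \<tau>)) (U p \<inter> cell \<tau>)
      \<and> openin (top_of_set (cell \<tau>)) ((\<Union>(cell ` L) - U p) \<inter> cell \<tau>)" if "\<tau> \<in> L" for \<tau>
    using cell_cases[OF that]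
  proof
    assume "cell \<tau> \<subseteq> U p"
    then have "U p \<inter> cell \<tau> = cell \<tau>" "(\<Union>(cell ` L) - U p) \<inter> cell \<tau> = {}" by auto
    then show ?thesis by simp
  next
    assume "U p \<inter> cell \<tau> = {}"
    then have "U p \<inter> cell \<tau> = {}" "(\<Union>(cell ` L) - U p) \<inter> cell \<tau> = cell \<tau>"
      using that by auto
    then show ?thesis by simp
  qed
  then show "openin (realization L) (U p) \<and> closedin (realization L) (U p)"
    using sub by (auto simp: closedin_def openin_realization topspace_realization)
qed

lemma bij_betw_pi0_realization:
  assumes KL: "K \<subseteq> L"
    and edges: "\<And>\<sigma> u v. \<lbrakk>\<sigma> \<in> L; u \<in> \<sigma>; v \<in> \<sigma>\<rbrakk> \<Longrightarrow> {u, v} \<in> K"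
  shows "bij_betw (pi0_map (realization K) (realization L) (\<lambda>x. x))
    (path_components_of (realization K)) (path_components_of (realization L))"
proof (rule bij_betw_pi0_map)
  show "continuous_map (realization K) (realization L) (\<lambda>x. x)"
    using KL by (rule continuous_map_realization_inclusion)
next
  fix f g
  assume f: "f \<in> topspace (realization K)" and g: "g \<in> topspace (realization K)"
    and fg: "path_component_of (realization L) f g"
  obtain \<sigma> where \<sigma>: "\<sigma> \<in> K" "f \<in> cell \<sigma>" using f by (auto simp: topspace_realization)
  obtain \<tau> where \<tau>: "\<tau> \<in> K" "g \<in> cell \<tau>" using g by (auto simp: topspace_realization)
  obtain u where u: "u \<in> \<sigma>" "vertex u \<in> cell \<sigma>" using cell_has_vertex[OF \<sigma>(2)] .
  obtain v where v: "v \<in> \<tau>" "vertex v \<in> cell \<tau>" using cell_has_vertex[OF \<tau>(2)] .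
  \<comment> \<open>The part of \<open>L\<close> lying over the path component of \<open>f\<close> in \<open>K\<close>: it traps any path from \<open>f\<close>.\<close>
  define U where
    "U = \<Union>{cell \<sigma> |\<sigma>. \<sigma> \<in> L \<and> (\<exists>u\<in>\<sigma>. path_component_of (realization K) f (vertex u))}"
  have "f \<in> U"
    using \<sigma> u KL path_component_of_realization_cell[OF \<sigma> u(2)] unfolding U_def by blast
  obtain T where T: "connectedin (realization L) T" "f \<in> T" "g \<in> T"
    using fg path_connectedin_imp_connectedin by (metis path_component_of)
  have "openin (realization L) U" "closedin (realization L) U"
    using clopen_cells_over_path_component(1)[where L = L and K = K and p = f, folded U_def] edges
    by simp_all
  then have "T \<subseteq> U \<or> disjnt T U"
    using T(1) by (intro connectedin_clopen_cases)
  then have "g \<in> U"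
    using \<open>f \<in> U\<close> T(2,3) by (auto simp: disjnt_iff)
  moreover have "\<tau> \<in> L"
    using \<tau>(1) KL by blast
  ultimately have "path_component_of (realization K) f (vertex v)"
    using clopen_cells_over_path_component(2)[where L = L and K = K and p = f, folded U_def]
      edges \<tau>(2) v(1) by simp
  moreover have "path_component_of (realization K) (vertex v) g"
    by (rule path_component_of_realization_cell[OF \<tau>(1) v(2) \<tau>(2)])
  ultimately show "path_component_of (realization K) f g"
    by (rule path_component_of_trans)
next
  fix g assume "g \<in> topspace (realization L)"
  then obtain \<tau> where \<tau>: "\<tau> \<in> L" "g \<in> cell \<tau>" by (auto simp: topspace_realization)
  obtain v where v: "v \<in> \<tau>" "vertex v \<in> cell \<tau>" using cell_has_vertex[OF \<tau>(2)] .
  have "vertex v \<in> topspace (realization K)"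
    unfolding topspace_realization
    by (rule UN_I[OF edges[OF \<tau>(1) v(1) v(1)]]) (simp add: vertex_in_cell)
  moreover have "path_component_of (realization L) (vertex v) g"
    by (rule path_component_of_realization_cell[OF \<tau>(1) v(2) \<tau>(2)])
  ultimately show "\<exists>f\<in>topspace (realization K). path_component_of (realization L) f g"
    by blast
qed

section \<open>The neighbourhood complex\<close>

lemma edge_in_VR_nbhd:
  assumes k: "k \<ge> 1" and tS: "t \<le> S" and \<sigma>: "\<sigma> \<in> VR d t Z" "u \<in> \<sigma>" "v \<in> \<sigma>"
  shows "{u, v} \<in> VR_nbhd Z d k S t"
proof -
  have Z: "u \<in> Z" "v \<in> Z" and le: "\<forall>x\<in>{u, v}. \<forall>y\<in>{u, v}. d x y \<le> ennreal t"
    using \<sigma> by (auto simp: VR_def)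
  have "ennreal t \<le> ennreal S"
    using tS by (rule ennreal_leI)
  then have "\<forall>y\<in>{u, v}. d u y \<le> ennreal S"
    using le by (meson insertI1 order_trans)
  moreover have "card {u, v} \<le> k + 1"
    using k by (simp add: card_insert_if)
  ultimately have "bounded_nbhd Z d k S u {u, v}"
    using Z by (simp add: bounded_nbhd_def)
  moreover have "{u, v} \<in> VR d t {u, v}"
    using le by (simp add: VR_def)
  ultimately show ?thesis
    using Z(1) unfolding VR_nbhd_def by blast
qed

theorem lemma15:
  fixes Z :: "'a set" and d :: "'a \<Rightarrow> 'a \<Rightarrow> ennreal" and k :: nat and S t :: real
  assumes "ep_metric Z d" and "finite Z"
    and "k \<ge> 1" and "S \<ge> 0" and "0 \<le> t" and "t \<le> S"
  shows "bij_betw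
    (pi0_map (realization (VR_nbhd Z d k S t)) (realization (VR d t Z)) (\<lambda>x. x))
    (path_components_of (realization (VR_nbhd Z d k S t)))
    (path_components_of (realization (VR d t Z)))"
  by (rule bij_betw_pi0_realization[OF VR_nbhd_subset edge_in_VR_nbhd[OF \<open>k \<ge> 1\<close> \<open>t \<le> S\<close>]])

end
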